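(* Let $n\ge1$ be an integer, let $t\neq 0$ and $y$ be real numbers, and let $s$ be a complex number with $\mathrm{Re}(s)>0$. Then $$\int_{0}^{\infty}e^{-su}\,\overline{B}_{n}(tu+y)\,du=n!\,\frac{t^{n}}{s^{n+1}}\left(\sum_{a=0}^{n}\frac{B_{a}(\{y\})}{a!}\frac{s^{a}}{t^{a}}-\frac{s}{t}\,\frac{e^{\{y\}s/t}}{e^{s/t}-1}\right),$$ where $\{y\}=y-[y]$.
   Context: $[y]$ is the largest integer $\le y$. The Bernoulli polynomials $B_n(x)$ are defined by $\frac{te^{xt}}{e^t-1}=\sum_{n\ge0}B_n(x)\frac{t^n}{n!}$ ($|t|<2\pi$). The Bernoulli functions are $\overline{B}_n(x)=B_n(x-[x])$ for $n>1$, and $\overline{B}_1(x)=x-[x]-1/2$ if $x\in\mathbb{R}\setminus\mathbb{Z}$, $\overline{B}_1(x)=0$ if $x\in\mathbb{Z}$. *)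

theory Defs
  imports "HOL-Complex_Analysis.Complex_Analysis"
begin

text \<open>
  The defining expansion is read in the ring of formal power series; division by
  \<open>fps_exp 1 - 1\<close>, which has subdegree 1, is exact there. The lemma
  \<open>bernoulli_poly_sums\<close> below confirms that this is the analytic expansion for
  \<open>norm t < 2 * pi\<close>.
\<close>

definition bernoulli_poly :: "nat \<Rightarrow> real \<Rightarrow> real" where
  "bernoulli_poly n x = fact n * fps_nth (fps_X * fps_exp x / (fps_exp 1 - 1)) n"

text \<open>The index 0 is not used; the value there is the one of the general formula.\<close>

definition bernoulli_fun :: "nat \<Rightarrow> real \<Rightarrow> real" where
  "bernoulli_fun n x =
     (if n = 1 then (if x \<in> \<int> then 0 else x - of_int \<lfloor>x\<rfloor> - 1 / 2)
      else bernoulli_poly n (x - of_int \<lfloor>x\<rfloor>))"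

lemma bernoulli_poly_sums:
  fixes x :: real and t :: complex
  assumes "t \<noteq> 0" "norm t < 2 * pi"
  shows "(\<lambda>n. of_real (bernoulli_poly n x) * t ^ n / fact n) sums
           (t * exp (of_real x * t) / (exp t - 1))"
proof -
  define G :: "real fps" where "G = fps_X * fps_exp x / (fps_exp 1 - 1)"
  define F :: "complex fps" where "F = Abs_fps (\<lambda>n. of_real (fps_nth G n))"
  have nz: "fps_exp 1 - 1 \<noteq> (0 :: 'b::field_char_0 fps)"
  proof
    assume "fps_exp 1 - 1 = (0 :: 'b fps)"
    hence "fps_nth (fps_exp 1 - 1 :: 'b fps) 1 = 0" by simp
    thus False by simp
  qed
  have sd: "subdegree (fps_exp 1 - 1 :: 'b::field_char_0 fps) = 1"
    by (rule subdegreeI) auto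
  have ex: "fps_exp c \<noteq> 0" for c :: "'b::field_char_0"
    using arg_cong[of "fps_exp c" 0 "\<lambda>f. fps_nth f 0"] by auto
  have "(fps_exp 1 - 1 :: real fps) dvd fps_X * fps_exp x"
  proof -
    have "fps_X * fps_exp x \<noteq> 0"
      using ex by simp
    moreover have "subdegree (fps_X * fps_exp x) \<ge> 1"
      using ex by (subst subdegree_mult) simp_all
    ultimately show ?thesis
      using fps_dvd_iff[OF nz] sd by metis
  qed
  hence G: "G * (fps_exp 1 - 1) = fps_X * fps_exp x"
    by (simp add: G_def)
  have F: "F * (fps_exp 1 - 1) = fps_X * fps_exp (of_real x)"
  proof (rule fps_ext)
    fix n
    have "fps_nth (F * (fps_exp 1 - 1)) n = of_real (fps_nth (G * (fps_exp 1 - 1)) n)"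
      by (auto simp: fps_mult_nth F_def intro!: sum.cong)
    also have "\<dots> = fps_nth (fps_X * fps_exp (of_real x)) n"
      unfolding G by simp
    finally show "fps_nth (F * (fps_exp 1 - 1)) n
        = fps_nth (fps_X * fps_exp (of_real x :: complex)) n" .
  qed
  have F': "F = fps_X * fps_exp (of_real x) / (fps_exp 1 - 1)"
    by (metis F nz nonzero_mult_div_cancel_right)
  define f where "f = (\<lambda>z::complex. if z = 0 then 1
                     else z * exp (of_real x * z) / (exp z - 1))"
  have e1: "(\<lambda>z::complex. z * exp (of_real x * z)) has_fps_expansion (fps_X * fps_exp (of_real x))"
    by (intro fps_expansion_intros)
  have e2: "(\<lambda>z::complex. exp (1 * z) - 1) has_fps_expansion (fps_exp 1 - 1)"
    by (intro fps_expansion_intros)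
  have e: "f has_fps_expansion F"
  proof -
    have "subdegree (fps_X * fps_exp (of_real x :: complex)) \<ge> 1"
      using ex by (subst subdegree_mult) simp_all
    moreover have "1 = fps_nth (fps_X * fps_exp (of_real x :: complex)) 1
        / fps_nth (fps_exp 1 - 1) 1"
      by simp
    ultimately have "(\<lambda>z::complex. if z = 0 then 1
        else z * exp (of_real x * z) / (exp (1 * z) - 1)) has_fps_expansion F"
      unfolding F' by (intro has_fps_expansion_divide[OF e1 e2 _ nz]) (simp_all only: sd)
    thus ?thesis by (simp only: f_def mult_1_left)
  qed
  have nz1: "exp z \<noteq> 1" if "z \<in> ball 0 (2 * pi)" "z \<noteq> 0" for z :: complex
  proof
    assume "exp z = 1"
    then obtain n :: int where n: "Re z = 0" "Im z = of_int (2 * n) * pi"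
      by (auto simp: exp_eq_1)
    have "\<bar>Im z\<bar> < 2 * pi"
      using that(1) abs_Im_le_cmod[of z] by (simp add: dist_norm)
    hence "\<bar>real_of_int n\<bar> < 1" using n by (simp add: abs_mult)
    hence "n = 0" by linarith
    with n that(2) show False by (simp add: complex_eq_iff)
  qed
  have "f holomorphic_on ball 0 (2 * pi) - {0}"
  proof -
    have "(\<lambda>z. z * exp (of_real x * z) / (exp z - 1)) holomorphic_on ball 0 (2 * pi) - {0}"
      using nz1 by (intro holomorphic_intros) auto
    thus ?thesis by (rule holomorphic_transform) (auto simp: f_def)
  qed
  moreover have "(f \<longlongrightarrow> f z) (at z within ball 0 (2 * pi))" if "z \<in> {0}" for z
    using has_fps_expansion_imp_continuous[OF e, of "ball 0 (2 * pi)"] that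
    unfolding continuous_within by blast
  ultimately have "f holomorphic_on ball 0 (2 * pi)"
    using no_isolated_singularity'[of "{0}" f "ball 0 (2 * pi)"] by blast
  hence "(\<lambda>n. fps_nth F n * t ^ n) sums f t"
    using assms by (intro has_fps_expansion_imp_sums_complex[OF e, of "2 * pi"]) auto
  thus ?thesis
    using assms(1) by (simp add: F_def f_def bernoulli_poly_def G_def)
qed

end

theory Submission
  imports Defs
begin

text \<open>
  The integrand has an explicit antiderivative. Put \<open>z = s / t\<close> and
  \<open>K r = (\<Sum>a=0..n. B\<^sub>a(r) / a! * z^a) - z * exp (z * r) / (exp z - 1)\<close>, for small
  \<open>z\<close> the negated
  tail of the generating series of the Bernoulli polynomials at \<open>z\<close>; it is called
  \<open>bernoulli_remainder\<close> below. Since \<open>B\<^sub>a\<^sub>+\<^sub>1' = (a + 1) * B\<^sub>a\<close>,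
  differentiation shifts the sum by one index, which gives
  \<open>K' = z * K - B\<^sub>n / n! * z^(n+1)\<close>
  (\<open>bernoulli_remainder_has_vector_derivative\<close>). Hence
  \<open>F u = - n! * t^n / s^(n+1) * exp (- s * u) * K (frac (t * u + y))\<close> satisfies
  \<open>F' u = exp (- s * u) * B\<^sub>n (frac (t * u + y))\<close> wherever \<open>t * u + y\<close> is not an
  integer.

  Only \<open>B\<^sub>1\<close> takes different values at 0 and 1, by exactly 1; in \<open>K\<close> this jump is cancelled
  by that of the exponential term, so that \<open>K 0 = K 1\<close> (\<open>bernoulli_remainder_0_eq_1\<close>) and
  \<open>F\<close> is continuous across the integer values of \<open>t * u + y\<close>. The fundamental theorem of
  calculus with finitely many exceptional points therefore applies on every bounded interval.
  As \<open>Re s > 0\<close> and \<open>K\<close> is bounded on the unit interval, \<open>F\<close> vanishes at infinity and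
  dominated convergence yields the value \<open>- F 0\<close>
  (\<open>has_integral_atLeast_antiderivative\<close>), which is the asserted right-hand side. The sign of
  \<open>t\<close> plays no role: \<open>exp z \<noteq> 1\<close> follows from \<open>Re z \<noteq> 0\<close>.
\<close>

section \<open>Bernoulli polynomials\<close>

text \<open>
  Division of formal power series is not exact in general; here it is, because
  \<open>fps_exp 1 - 1\<close> and \<open>fps_X\<close> both have subdegree 1.
\<close>

lemma fps_bernoulli_factor_mult:
  "fps_X / (fps_exp 1 - 1) * (fps_exp 1 - 1) = (fps_X :: 'a::field_char_0 fps)"
proof -
  have sd: "subdegree (fps_exp 1 - 1 :: 'a fps) = 1"
    by (rule subdegreeI) auto
  then have "(fps_exp 1 - 1 :: 'a fps) \<noteq> 0"
    by (metis subdegree_0 zero_neq_one)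
  then have "(fps_exp 1 - 1 :: 'a fps) dvd fps_X"
    using sd by (simp add: fps_dvd_iff)
  then show ?thesis
    by simp
qed

lemma fps_bernoulli_conv_mult:
  "fps_X * fps_exp x / (fps_exp 1 - 1)
     = fps_exp x * (fps_X / (fps_exp 1 - 1) :: 'a::field_char_0 fps)"
proof -
  have "(fps_exp 1 - 1 :: 'a fps) dvd fps_X"
    by (metis dvd_triv_right fps_bernoulli_factor_mult)
  then show ?thesis
    by (metis div_mult_swap mult.commute)
qed

lemma bernoulli_poly_div_fact:
  "bernoulli_poly n x / fact n = fps_nth (fps_exp x * (fps_X / (fps_exp 1 - 1))) n"
  by (simp add: bernoulli_poly_def fps_bernoulli_conv_mult)

text \<open>
  The relation \<open>B\<^sub>n\<^sub>+\<^sub>1' = (n + 1) * B\<^sub>n\<close>, normalized by factorials: both sides are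
  Cauchy products of the exponential series with the same series
  \<open>fps_X / (fps_exp 1 - 1)\<close>, which does not depend on \<open>x\<close>.
\<close>

lemma bernoulli_poly_div_fact_has_derivative:
  "((\<lambda>x. bernoulli_poly (Suc n) x / fact (Suc n))
      has_real_derivative bernoulli_poly n x / fact n) (at x)"
proof -
  define c where "c = fps_nth (fps_X / (fps_exp 1 - 1) :: real fps)"
  have eq: "bernoulli_poly m x / fact m = (\<Sum>i\<le>m. x ^ i / fact i * c (m - i))" for m x
    by (simp add: bernoulli_poly_div_fact fps_mult_nth c_def atLeast0AtMost)
  have "((\<lambda>x. \<Sum>i\<le>n. x ^ Suc i / fact (Suc i) * c (n - i))
      has_real_derivative (\<Sum>i\<le>n. x ^ i / fact i * c (n - i))) (at x)"
  proof (intro DERIV_sum)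
    fix i
    have "((\<lambda>x. x ^ Suc i / fact (Suc i) * c (n - i)) has_real_derivative
        (real (Suc i) * x ^ i) / fact (Suc i) * c (n - i)) (at x)"
      by (auto intro!: derivative_eq_intros simp del: power_Suc)
    moreover have "(real (Suc i) * x ^ i) / fact (Suc i) = x ^ i / fact i"
      by (simp only: fact_Suc of_nat_mult mult_divide_mult_cancel_left_if) simp
    ultimately show "((\<lambda>x. x ^ Suc i / fact (Suc i) * c (n - i)) has_real_derivative
        x ^ i / fact i * c (n - i)) (at x)"
      by simp
  qed
  then have "((\<lambda>x. c (Suc n) + (\<Sum>i\<le>n. x ^ Suc i / fact (Suc i) * c (n - i)))
      has_real_derivative 0 + (\<Sum>i\<le>n. x ^ i / fact i * c (n - i))) (at x)"
    by (intro DERIV_add DERIV_const)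
  then show ?thesis
    unfolding eq sum.atMost_Suc_shift by simp
qed

lemma bernoulli_poly_0: "bernoulli_poly 0 x = 1"
  and bernoulli_poly_1: "bernoulli_poly (Suc 0) x = x - 1 / 2"
proof -
  define C where "C = (fps_X / (fps_exp 1 - 1) :: real fps)"
  have C: "C * (fps_exp 1 - 1) = fps_X"
    by (simp add: C_def fps_bernoulli_factor_mult)
  have C0: "fps_nth C 0 = 1"
    using arg_cong[OF C, of "\<lambda>f. fps_nth f (Suc 0)"] by (simp add: fps_mult_nth)
  have C1: "fps_nth C (Suc 0) = - 1 / 2"
    using arg_cong[OF C, of "\<lambda>f. fps_nth f (Suc (Suc 0))"] C0
    by (simp add: fps_mult_nth)
  show "bernoulli_poly 0 x = 1"
    using bernoulli_poly_div_fact[of 0 x] C0 by (simp add: C_def)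
  show "bernoulli_poly (Suc 0) x = x - 1 / 2"
    using bernoulli_poly_div_fact[of "Suc 0" x] C0 C1 by (simp add: C_def fps_mult_nth)
qed

lemma bernoulli_poly_at_1:
  "bernoulli_poly n 1 / fact n = bernoulli_poly n 0 / fact n + (if n = 1 then 1 else 0)"
proof -
  let ?C = "fps_X / (fps_exp 1 - 1) :: real fps"
  have "fps_exp 1 * ?C - fps_exp 0 * ?C = fps_X"
    using fps_bernoulli_factor_mult[where 'a=real] by (simp add: algebra_simps)
  then have "fps_exp 1 * ?C = fps_exp 0 * ?C + fps_X"
    by (simp add: algebra_simps)
  then show ?thesis
    by (simp only: bernoulli_poly_div_fact fps_add_nth fps_X_nth)
qed

lemma continuous_on_bernoulli_poly: "continuous_on A (bernoulli_poly n)"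
proof (cases n)
  case 0
  then show ?thesis
    by (simp add: bernoulli_poly_0 cong: continuous_on_cong)
next
  case (Suc m)
  have "continuous_on A (\<lambda>x. bernoulli_poly n x / fact n)"
    unfolding Suc
    by (rule DERIV_continuous_on)
      (rule has_field_derivative_at_within[OF bernoulli_poly_div_fact_has_derivative])
  then have "continuous_on A (\<lambda>x. fact n * (bernoulli_poly n x / fact n))"
    by (rule continuous_on_mult_left)
  then show ?thesis
    by simp
qed

text \<open>
  The excluded case is that of the first Bernoulli function at an integer, whose value is 0
  by convention and not \<open>B\<^sub>1(0) = - 1 / 2\<close>.
\<close>

lemma bernoulli_fun_eq:
  assumes "x \<notin> \<int> \<or> n \<noteq> 1"
  shows "bernoulli_fun n x = bernoulli_poly n (frac x)"
  using assms by (auto simp: bernoulli_fun_def frac_def bernoulli_poly_1)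

lemma bernoulli_fun_bounded:
  obtains M where "\<And>x. \<bar>bernoulli_fun n x\<bar> \<le> M"
proof -
  have "bounded (bernoulli_poly n ` {0..1})"
    by (intro compact_imp_bounded compact_continuous_image continuous_on_bernoulli_poly) auto
  then obtain M where M: "\<And>r. r \<in> {0..1} \<Longrightarrow> \<bar>bernoulli_poly n r\<bar> \<le> M"
    unfolding bounded_iff by (metis image_eqI real_norm_def)
  have "\<bar>bernoulli_fun n x\<bar> \<le> M" for x
  proof (cases "x \<notin> \<int> \<or> n \<noteq> 1")
    case True
    then show ?thesis
      using M[of "frac x"] by (simp add: bernoulli_fun_eq frac_lt_1 less_imp_le)
  next
    case False
    then show ?thesis
      using M[of 0] by (auto simp: bernoulli_fun_def)
  qed
  then show ?thesis
    using that by blast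
qed

section \<open>Functions of the fractional part\<close>

lemma frac_eq_diff_of_int:
  assumes "of_int m \<le> x" "x < of_int m + 1"
  shows "frac x = x - of_int m"
  using assms by (simp add: frac_unique_iff)

lemma continuous_on_compose_frac:
  fixes f :: "real \<Rightarrow> 'a::topological_space"
  assumes f: "continuous_on {0..1} f" and f01: "f 0 = f 1"
  shows "continuous_on UNIV (\<lambda>x. f (frac x))"
proof -
  have piece: "continuous_on {of_int m..of_int m + 1} (\<lambda>x. f (frac x))" for m
  proof -
    have "continuous_on {of_int m..of_int m + 1} (\<lambda>x. f (x - of_int m))"
      by (rule continuous_on_compose2[OF f]) (auto intro!: continuous_intros)
    moreover have "f (frac x) = f (x - of_int m)" if "x \<in> {of_int m..of_int m + 1}" for x
    proof (cases "x = of_int m + 1")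
      case True
      then have "frac x = 0" by simp
      with True f01 show ?thesis by simp
    next
      case False
      with that show ?thesis by (simp add: frac_eq_diff_of_int[of m])
    qed
    ultimately show ?thesis
      by (metis (no_types, lifting) continuous_on_cong)
  qed
  \<comment> \<open>Two adjacent pieces are glued to obtain a neighbourhood of each point, integers included.\<close>
  have "isCont (\<lambda>x. f (frac x)) x" for x
  proof -
    define m where "m = \<lfloor>x\<rfloor>"
    have mx: "of_int m \<le> x" "x < of_int m + 1"
      by (simp_all add: m_def)
    have "continuous_on ({of_int (m - 1)..of_int (m - 1) + 1} \<union> {of_int m..of_int m + 1})
        (\<lambda>x. f (frac x))"
      by (intro continuous_on_closed_Un piece) auto
    then have "continuous_on {of_int m - 1<..<of_int m + 1} (\<lambda>x. f (frac x))"
      by (rule continuous_on_subset) auto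
    then show ?thesis
      using mx by (simp add: continuous_on_eq_continuous_at)
  qed
  then show ?thesis
    by (simp add: continuous_at_imp_continuous_on)
qed

lemma has_vector_derivative_compose_frac:
  assumes f: "(f has_vector_derivative f') (at (frac (t * u + y)))" and "t * u + y \<notin> \<int>"
  shows "((\<lambda>u. f (frac (t * u + y))) has_vector_derivative t *\<^sub>R f') (at u)"
proof -
  define m where "m = \<lfloor>t * u + y\<rfloor>"
  have m: "of_int m < t * u + y" "t * u + y < of_int m + 1"
    using assms(2) floor_correct[of "t * u + y"]
    by (auto simp: m_def less_le intro: Ints_of_int dest: sym)
  define S where "S = {u. of_int m < t * u + y \<and> t * u + y < of_int m + 1}"
  have S: "open S"
    unfolding S_def by (intro open_Collect_conj open_Collect_less continuous_intros)
  have "((\<lambda>u. t * u + y - of_int m) has_vector_derivative t) (at u)"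
    by (auto intro!: derivative_eq_intros simp flip: has_real_derivative_iff_has_vector_derivative)
  moreover have "(f has_vector_derivative f') (at (t * u + y - of_int m))"
    using f frac_eq_diff_of_int[of m "t * u + y"] m by simp
  ultimately have "((f \<circ> (\<lambda>u. t * u + y - of_int m)) has_vector_derivative t *\<^sub>R f') (at u)"
    by (rule vector_diff_chain_at)
  then show ?thesis
    by (rule has_vector_derivative_transform_within_open[OF _ S])
      (use m in \<open>auto simp: S_def frac_eq_diff_of_int[of m]\<close>)
qed

lemma finite_affine_Ints:
  fixes t y a b :: real
  assumes "t \<noteq> 0"
  shows "finite {u \<in> {a..b}. t * u + y \<in> \<int>}"
proof -
  have "finite {k \<in> \<int>. \<bar>k\<bar> \<le> \<bar>t\<bar> * (\<bar>a\<bar> + \<bar>b\<bar>) + \<bar>y\<bar>}"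
    by (rule finite_abs_int_segment)
  moreover have "(\<lambda>u. t * u + y) ` {u \<in> {a..b}. t * u + y \<in> \<int>}
      \<subseteq> {k \<in> \<int>. \<bar>k\<bar> \<le> \<bar>t\<bar> * (\<bar>a\<bar> + \<bar>b\<bar>) + \<bar>y\<bar>}"
  proof clarsimp
    fix u assume "a \<le> u" "u \<le> b"
    then have "\<bar>t * u\<bar> \<le> \<bar>t\<bar> * (\<bar>a\<bar> + \<bar>b\<bar>)"
      unfolding abs_mult by (intro mult_left_mono) auto
    then show "\<bar>t * u + y\<bar> \<le> \<bar>t\<bar> * (\<bar>a\<bar> + \<bar>b\<bar>) + \<bar>y\<bar>"
      by linarith
  qed
  ultimately have "finite ((\<lambda>u. t * u + y) ` {u \<in> {a..b}. t * u + y \<in> \<int>})"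
    by (rule finite_subset[rotated])
  moreover have "inj_on (\<lambda>u. t * u + y) {u \<in> {a..b}. t * u + y \<in> \<int>}"
    using assms by (intro inj_onI) simp
  ultimately show ?thesis
    by (rule finite_imageD)
qed

section \<open>Integrals over a half-line\<close>

text \<open>
  A fundamental theorem of calculus on a half-line: the exceptional set \<open>S\<close> has to be finite
  only on bounded intervals, and the integrable majorant \<open>h\<close> allows passing to the limit.
\<close>

lemma has_integral_atLeast_antiderivative:
  fixes F f :: "real \<Rightarrow> 'a::euclidean_space"
  assumes fin: "\<And>b. finite (S \<inter> {a..b})"
    and deriv: "\<And>x. x > a \<Longrightarrow> x \<notin> S \<Longrightarrow> (F has_vector_derivative f x) (at x)"
    and cont: "continuous_on {a..} F"
    and h: "h integrable_on {a..}"
    and bound: "\<And>x. x \<ge> a \<Longrightarrow> norm (f x) \<le> h x"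
    and lim: "(F \<longlongrightarrow> L) at_top"
  shows "(f has_integral (L - F a)) {a..}"
proof (rule has_integral_dominated_convergence[where h = h
      and f = "\<lambda>k x. if x \<in> {a..a + real k} then f x else 0"
      and y = "\<lambda>k. F (a + real k) - F a"])
  show "((\<lambda>x. if x \<in> {a..a + real k} then f x else 0)
      has_integral F (a + real k) - F a) {a..}" for k
  proof (subst has_integral_restrict)
    show "(f has_integral F (a + real k) - F a) {a..a + real k}"
    proof (rule fundamental_theorem_of_calculus_interior_strong[OF fin[of "a + real k"]])
      show "continuous_on {a..a + real k} F"
        using cont by (rule continuous_on_subset) auto
    qed (auto intro: deriv)
  qed auto
  show "h integrable_on {a..}"
    by fact
  show "\<forall>x\<in>{a..}. norm (if x \<in> {a..a + real k} then f x else 0) \<le> h x" for k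
    using bound order_trans[OF norm_ge_zero bound] by simp
  show "\<forall>x\<in>{a..}. (\<lambda>k. if x \<in> {a..a + real k} then f x else 0) \<longlonglongrightarrow> f x"
  proof
    fix x assume "x \<in> {a..}"
    moreover have "eventually (\<lambda>k. x - a \<le> real k) sequentially"
      by (meson eventually_sequentiallyI nat_ceiling_le_eq)
    ultimately have "eventually (\<lambda>k. (if x \<in> {a..a + real k} then f x else 0) = f x) sequentially"
      by (simp add: eventually_mono[of "\<lambda>k. x - a \<le> real k"])
    then show "(\<lambda>k. if x \<in> {a..a + real k} then f x else 0) \<longlonglongrightarrow> f x"
      by (rule tendsto_eventually)
  qed
  have "filterlim (\<lambda>k. a + real k) at_top sequentially"
    by (intro filterlim_tendsto_add_at_top[OF tendsto_const] filterlim_real_sequentially)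
  then have "(\<lambda>k. F (a + real k)) \<longlonglongrightarrow> L"
    by (rule filterlim_compose[OF lim])
  then show "(\<lambda>k. F (a + real k) - F a) \<longlonglongrightarrow> L - F a"
    by (intro tendsto_intros)
qed

lemma exp_mult_bounded_tendsto_0:
  fixes g :: "real \<Rightarrow> complex"
  assumes "Re s > 0" and "\<And>u. norm (g u) \<le> M"
  shows "((\<lambda>u. exp (- s * of_real u) * g u) \<longlongrightarrow> 0) at_top"
proof (rule Lim_null_comparison)
  show "\<forall>\<^sub>F u in at_top. norm (exp (- s * of_real u) * g u) \<le> exp (- Re s * u) * M"
    using assms(2) by (intro always_eventually allI) (simp add: norm_mult mult_left_mono)
  show "((\<lambda>u. exp (- Re s * u) * M) \<longlongrightarrow> 0) at_top"
    using assms(1) by real_asymp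
qed

section \<open>The Laplace transform\<close>

text \<open>
  The partial sum, up to the index \<open>n\<close>, of the generating series of the Bernoulli polynomials,
  minus the closed form of the whole series. For a fixed \<open>z\<close> it is regarded as a function of
  the real argument \<open>r\<close>. It is defined for every \<open>z\<close>, also outside the disc of convergence
  of the series; when \<open>exp z = 1\<close>, division by zero makes the closed form 0.
\<close>

definition bernoulli_remainder :: "nat \<Rightarrow> complex \<Rightarrow> real \<Rightarrow> complex" where
  "bernoulli_remainder n z r =
     (\<Sum>a=0..n. of_real (bernoulli_poly a r / fact a) * z ^ a)
       - z * exp (of_real r * z) / (exp z - 1)"

text \<open>
  Differentiation multiplies the closed form by \<open>z\<close> and does the same to the partial sum, up to
  its last term.
\<close>

lemma bernoulli_remainder_has_vector_derivative:
  "(bernoulli_remainder n z has_vector_derivative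
      z * bernoulli_remainder n z r - of_real (bernoulli_poly n r / fact n) * z ^ Suc n) (at r)"
proof -
  define b where "b = (\<lambda>a r. complex_of_real (bernoulli_poly a r / fact a))"
  have b0: "b 0 = (\<lambda>r. 1)"
    by (simp add: b_def bernoulli_poly_0)
  have b: "(b (Suc a) has_vector_derivative b a r) (at r)" for a
    unfolding b_def
    by (intro has_vector_derivative_of_real bernoulli_poly_div_fact_has_derivative)
  have sum: "((\<lambda>r. \<Sum>a=0..n. b a r * z ^ a) has_vector_derivative
      z * (\<Sum>a=0..n. b a r * z ^ a) - b n r * z ^ Suc n) (at r)"
  proof (induction n)
    case 0
    then show ?case by (simp add: b0)
  next
    case (Suc n)
    have "((\<lambda>r. (\<Sum>a=0..n. b a r * z ^ a) + b (Suc n) r * z ^ Suc n) has_vector_derivative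
        (z * (\<Sum>a=0..n. b a r * z ^ a) - b n r * z ^ Suc n) + b n r * z ^ Suc n) (at r)"
      by (intro has_vector_derivative_add Suc.IH has_vector_derivative_mult_left b)
    then show ?case
      by (simp add: algebra_simps)
  qed
  have "((\<lambda>w. z * exp (w * z)) has_field_derivative z * (z * exp (of_real r * z)))
      (at (of_real r))"
    by (auto intro!: derivative_eq_intros)
  then have "((\<lambda>w. z * exp (w * z) / (exp z - 1)) has_field_derivative
      z * (z * exp (of_real r * z)) / (exp z - 1)) (at (of_real r))"
    by (rule DERIV_cdivide)
  then have "((\<lambda>r. z * exp (of_real r * z) / (exp z - 1)) has_vector_derivative
      z * (z * exp (of_real r * z)) / (exp z - 1)) (at r)"
    by (rule has_vector_derivative_real_field)
  from has_vector_derivative_diff[OF sum this]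
  show ?thesis
    unfolding bernoulli_remainder_def b_def by (simp add: algebra_simps)
qed

lemma bernoulli_remainder_0_eq_1:
  assumes "n \<ge> 1" "exp z \<noteq> 1"
  shows "bernoulli_remainder n z 0 = bernoulli_remainder n z 1"
proof -
  have "(\<Sum>a=0..n. of_real (bernoulli_poly a 1 / fact a) * z ^ a)
      = (\<Sum>a=0..n. of_real (bernoulli_poly a 0 / fact a) * z ^ a + (if a = 1 then z else 0))"
    unfolding bernoulli_poly_at_1 by (intro sum.cong) (auto simp: algebra_simps)
  also have "\<dots> = (\<Sum>a=0..n. of_real (bernoulli_poly a 0 / fact a) * z ^ a) + z"
    using assms(1) by (simp add: sum.distrib)
  finally have "bernoulli_remainder n z 1 - bernoulli_remainder n z 0
      = z - (z * exp z / (exp z - 1) - z / (exp z - 1))"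
    by (simp add: bernoulli_remainder_def)
  also have "\<dots> = z - z * (exp z - 1) / (exp z - 1)"
    by (simp add: diff_divide_distrib right_diff_distrib)
  also have "\<dots> = 0"
    using assms(2) by simp
  finally show ?thesis
    by simp
qed

theorem mainTheorem7:
  fixes n :: nat and t y :: real and s :: complex
  assumes "n \<ge> 1" and "t \<noteq> 0" and "Re s > 0"
  shows "((\<lambda>u::real. exp (- s * of_real u) * of_real (bernoulli_fun n (t * u + y))) has_integral
           fact n * (of_real t ^ n / s ^ (n + 1)) *
             ((\<Sum>a=0..n. of_real (bernoulli_poly a (frac y)) / fact a * (s ^ a / of_real t ^ a))
              - s / of_real t *
                  (exp (of_real (frac y) * s / of_real t) / (exp (s / of_real t) - 1)))) {0..}"
proof -
  define z where "z = s / of_real t"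
  define K where "K = bernoulli_remainder n z"
  define c where "c = fact n * (of_real t ^ n / s ^ (n + 1))"
  define F where "F = (\<lambda>u. - c * (exp (- s * of_real u) * K (frac (t * u + y))))"
  have s: "s \<noteq> 0" "s = of_real t * z"
    using assms by (auto simp: z_def)
  have "Re z \<noteq> 0"
    using assms by (simp add: z_def)
  then have "exp z \<noteq> 1"
    by (auto simp: exp_eq_1)
  then have K01: "K 0 = K 1"
    using assms(1) by (simp add: K_def bernoulli_remainder_0_eq_1)
  have contK: "continuous_on A K" for A
    unfolding K_def
    by (rule continuous_on_vector_derivative)
      (rule has_vector_derivative_at_within[OF bernoulli_remainder_has_vector_derivative])
  have contFrac: "continuous_on UNIV (\<lambda>x. K (frac x))"
    using contK K01 by (rule continuous_on_compose_frac)
  have "bounded (K ` {0..1})"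
    by (intro compact_imp_bounded compact_continuous_image contK) auto
  then obtain B where B: "\<And>r. r \<in> {0..1} \<Longrightarrow> norm (K r) \<le> B"
    unfolding bounded_iff by (metis image_eqI)
  obtain M where M: "\<And>x. \<bar>bernoulli_fun n x\<bar> \<le> M"
    using bernoulli_fun_bounded by blast

  have "((\<lambda>u. exp (- s * of_real u) * of_real (bernoulli_fun n (t * u + y)))
      has_integral (0 - F 0)) {0..}"
  proof (rule has_integral_atLeast_antiderivative[where S = "{u. t * u + y \<in> \<int>}"
        and h = "\<lambda>u. exp (- Re s * u) * M"])
    show "finite ({u. t * u + y \<in> \<int>} \<inter> {0..b})" for b
      using finite_affine_Ints[OF assms(2), of 0 b y] by (simp add: Int_def conj_commute)
  next
    fix u assume "u \<notin> {u. t * u + y \<in> \<int>}"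
    then have u: "t * u + y \<notin> \<int>" by simp
    define r where "r = frac (t * u + y)"
    have "((\<lambda>w. exp (- s * w)) has_field_derivative exp (- s * of_real u) * (- s)) (at (of_real u))"
      by (auto intro!: derivative_eq_intros)
    then have "((\<lambda>u. exp (- s * of_real u)) has_vector_derivative exp (- s * of_real u) * (- s)) (at u)"
      by (rule has_vector_derivative_real_field)
    moreover have "((\<lambda>u. K (frac (t * u + y))) has_vector_derivative
        t *\<^sub>R (z * K r - of_real (bernoulli_poly n r / fact n) * z ^ Suc n)) (at u)"
      unfolding K_def r_def
      by (intro has_vector_derivative_compose_frac bernoulli_remainder_has_vector_derivative u)
    ultimately have "(F has_vector_derivative
        - c * (exp (- s * of_real u) * (t *\<^sub>R (z * K r - of_real (bernoulli_poly n r / fact n) * z ^ Suc n))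
          + exp (- s * of_real u) * (- s) * K (frac (t * u + y)))) (at u)"
      unfolding F_def by (intro has_vector_derivative_mult_right has_vector_derivative_mult)
    moreover have "- c * (exp (- s * of_real u) * (t *\<^sub>R (z * K r - of_real (bernoulli_poly n r / fact n) * z ^ Suc n))
          + exp (- s * of_real u) * (- s) * K (frac (t * u + y)))
        = exp (- s * of_real u) * of_real (bernoulli_fun n (t * u + y))"
    proof -
      \<comment> \<open>The two terms in \<open>K\<close> cancel because \<open>t * z = s\<close>; the constant \<open>c\<close> normalizes the rest.\<close>
      have "c * (of_real t * z ^ Suc n) = fact n"
        using s(1) assms(2) by (simp add: c_def z_def field_simps)
      then have *: "c * (of_real t * z ^ Suc n) * (of_real (bernoulli_poly n r) / fact n)
          = of_real (bernoulli_poly n r)"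
        by simp
      have "- c * (exp (- s * of_real u) * (t *\<^sub>R (z * K r - of_real (bernoulli_poly n r / fact n) * z ^ Suc n))
          + exp (- s * of_real u) * (- s) * K (frac (t * u + y)))
        = exp (- s * of_real u)
            * (c * (of_real t * z ^ Suc n) * (of_real (bernoulli_poly n r) / fact n))"
        unfolding r_def[symmetric] scaleR_conv_of_real
        by (subst (3) s(2)) (simp add: algebra_simps)
      also have "\<dots> = exp (- s * of_real u) * of_real (bernoulli_fun n (t * u + y))"
        unfolding * using u by (simp add: bernoulli_fun_eq r_def)
      finally show ?thesis .
    qed
    ultimately show "(F has_vector_derivative
        exp (- s * of_real u) * of_real (bernoulli_fun n (t * u + y))) (at u)"
      by simp
  next
    show "continuous_on {0..} F"
      unfolding F_def
      by (intro continuous_intros continuous_on_compose2[OF contFrac]) auto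
  next
    show "(\<lambda>u. exp (- Re s * u) * M) integrable_on {0..}"
      using assms(3) by (intro integrable_on_mult_left integrable_on_exp_minus_to_infinity)
  next
    show "norm (exp (- s * of_real u) * of_real (bernoulli_fun n (t * u + y)))
        \<le> exp (- Re s * u) * M" for u
      using M by (simp add: norm_mult mult_left_mono)
  next
    have "((\<lambda>u. exp (- s * of_real u) * K (frac (t * u + y))) \<longlongrightarrow> 0) at_top"
      using assms(3) B
      by (intro exp_mult_bounded_tendsto_0[where M = B]) (auto simp: frac_lt_1 less_imp_le)
    then show "(F \<longlongrightarrow> 0) at_top"
      unfolding F_def by (rule tendsto_mult_right_zero)
  qed
  moreover have "0 - F 0 = fact n * (of_real t ^ n / s ^ (n + 1)) *
             ((\<Sum>a=0..n. of_real (bernoulli_poly a (frac y)) / fact a * (s ^ a / of_real t ^ a))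
              - s / of_real t *
                  (exp (of_real (frac y) * s / of_real t) / (exp (s / of_real t) - 1)))"
    by (simp add: F_def K_def c_def bernoulli_remainder_def z_def power_divide)
  ultimately show ?thesis
    by simp
qed

end
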